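(* Let $U$ be an ultrafilter on $\omega$ and $I$ a deterministic ideal on $\omega$ with $\mathrm{fin}\subseteq I\subseteq U^*$. If $U\not\ge_T I^\omega$, then $U$ has the $I$-pseudo intersection property, i.e. for every sequence $\langle X_n:n<\omega\rangle\subseteq U$ there is $X\in U$ with $X\setminus X_n\in I$ for all $n$.
   Context: $\mathrm{fin}$ is the ideal of finite subsets of $\omega$; $U^*=\{\omega\setminus A:A\in U\}$; for an ideal $I$, $I^*=\{\omega\setminus A:A\in I\}$ is the dual filter. An ideal $I$ is deterministic if there is a cofinal $\mathcal{B}\subseteq I$ (under inclusion) such that for every $\mathcal{A}\subseteq\mathcal{B}$, either $\bigcup\mathcal{A}\in I$ or $\bigcup\mathcal{A}\in I^*$. Ideals are ordered by inclusion, ultrafilters by reverse inclusion, $I^\omega=\prod_{n<\omega}I$ coordinatewise. $P\le_TQ$ (Tukey) iff there is a map $Q\to P$ sending cofinal subsets to cofinal subsets. *)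

theory Defs
  imports Main "HOL-Library.FuncSet"
begin

definition is_ideal :: "'a set set \<Rightarrow> bool" where
  "is_ideal I \<longleftrightarrow> {} \<in> I \<and> UNIV \<notin> I \<and>
     (\<forall>A\<in>I. \<forall>B. B \<subseteq> A \<longrightarrow> B \<in> I) \<and> (\<forall>A\<in>I. \<forall>B\<in>I. A \<union> B \<in> I)"

definition is_set_filter :: "'a set set \<Rightarrow> bool" where
  "is_set_filter F \<longleftrightarrow> UNIV \<in> F \<and> {} \<notin> F \<and>
     (\<forall>A\<in>F. \<forall>B. A \<subseteq> B \<longrightarrow> B \<in> F) \<and> (\<forall>A\<in>F. \<forall>B\<in>F. A \<inter> B \<in> F)"

definition is_ultrafilter :: "'a set set \<Rightarrow> bool" where
  "is_ultrafilter U \<longleftrightarrow> is_set_filter U \<and> (\<forall>A. A \<in> U \<or> UNIV - A \<in> U)"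

definition fin_ideal :: "'a set set" where
  "fin_ideal = {A. finite A}"

definition dual_family :: "'a set set \<Rightarrow> 'a set set" where
  "dual_family F = {UNIV - A | A. A \<in> F}"

definition is_cofinal :: "'a set \<Rightarrow> ('a \<Rightarrow> 'a \<Rightarrow> bool) \<Rightarrow> 'a set \<Rightarrow> bool" where
  "is_cofinal P le C \<longleftrightarrow> C \<subseteq> P \<and> (\<forall>p\<in>P. \<exists>c\<in>C. le p c)"

text \<open>An order is given by its carrier set together with its order relation.\<close>

definition tukey_le ::
  "'a set \<Rightarrow> ('a \<Rightarrow> 'a \<Rightarrow> bool) \<Rightarrow> 'b set \<Rightarrow> ('b \<Rightarrow> 'b \<Rightarrow> bool) \<Rightarrow> bool" where
  "tukey_le P leP Q leQ \<longleftrightarrow>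
     (\<exists>f. f \<in> Q \<rightarrow> P \<and> (\<forall>C. is_cofinal Q leQ C \<longrightarrow> is_cofinal P leP (f ` C)))"

definition deterministic :: "'a set set \<Rightarrow> bool" where
  "deterministic I \<longleftrightarrow>
     (\<exists>\<B>. is_cofinal I (\<subseteq>) \<B> \<and>
        (\<forall>\<A>. \<A> \<subseteq> \<B> \<longrightarrow> \<Union>\<A> \<in> I \<or> \<Union>\<A> \<in> dual_family I))"

definition omega_power :: "'a set \<Rightarrow> (nat \<Rightarrow> 'a) set" where
  "omega_power P = UNIV \<rightarrow> P"

definition coordwise :: "('a \<Rightarrow> 'a \<Rightarrow> bool) \<Rightarrow> (nat \<Rightarrow> 'a) \<Rightarrow> (nat \<Rightarrow> 'a) \<Rightarrow> bool" where
  "coordwise le f g \<longleftrightarrow> (\<forall>n. le (f n) (g n))"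

definition pseudo_intersection_property :: "'a set set \<Rightarrow> 'a set set \<Rightarrow> bool" where
  "pseudo_intersection_property I U \<longleftrightarrow>
     (\<forall>X :: nat \<Rightarrow> 'a set. range X \<subseteq> U \<longrightarrow> (\<exists>Y\<in>U. \<forall>n. Y - X n \<in> I))"

end

theory Submission
  imports Defs
begin

text \<open>If a decreasing sequence \<open>X\<close> in \<open>U\<close> has no \<open>I\<close>-pseudo intersection in \<open>U\<close>, then for
  \<open>b \<in> I\<^sup>\<omega>\<close> the set \<open>Z\<^sub>b = (\<Union>n. b n \<inter> X n)\<close> satisfies \<open>Z\<^sub>b - X n \<in> I\<close> for all \<open>n\<close>, so its
  complement is in \<open>U\<close>. The map \<open>b \<mapsto> - Z\<^sub>b\<close> on \<open>\<B>\<^sup>\<omega>\<close>, where \<open>\<B>\<close> witnesses determinism, sends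
  unbounded sets to unbounded sets: if some \<open>Y \<in> U\<close> is disjoint from all \<open>Z\<^sub>b\<close> with \<open>b \<in> S\<close>, then
  no \<open>\<Union>b\<in>S. b n\<close> is in \<open>I\<^sup>*\<close>, because it misses \<open>Y \<inter> X n \<in> U\<close>; so all of them are in \<open>I\<close>.
  The cofinal map \<open>U \<rightarrow> I\<^sup>\<omega>\<close> sends \<open>Y\<close> to the supremum of all such \<open>b\<close>.\<close>

lemma ideal_UN_lessThan:
  fixes n :: nat
  assumes "is_ideal I" and "\<And>m. m < n \<Longrightarrow> A m \<in> I"
  shows "(\<Union>m<n. A m) \<in> I"
  using assms(2)
  by (induction n) (use assms(1) in \<open>auto simp: is_ideal_def lessThan_Suc\<close>)

lemma set_filter_INT_atMost:
  fixes n :: nat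
  assumes "is_set_filter F" and "range X \<subseteq> F"
  shows "(\<Inter>m\<le>n. X m) \<in> F"
  by (induction n) (use assms in \<open>auto simp: is_set_filter_def atMost_Suc\<close>)

text \<open>As \<open>X\<close> decreases, the terms with \<open>n \<ge> m\<close> lie inside
  \<open>X m\<close>; only the finitely many \<open>b n\<close> with \<open>n < m\<close>
  contribute.\<close>

lemma diagonal_diff_in_ideal:
  fixes X :: "nat \<Rightarrow> 'a set"
  assumes I: "is_ideal I" and "antimono X" and b: "\<And>n. b n \<in> I"
  shows "(\<Union>n. b n \<inter> X n) - X m \<in> I"
proof -
  have "X n \<subseteq> X m" if "\<not> n < m" for n
    using that antimonoD[OF \<open>antimono X\<close>] by simp
  then have "(\<Union>n. b n \<inter> X n) - X m \<subseteq> (\<Union>n<m. b n)"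
    by blast
  moreover have "(\<Union>n<m. b n) \<in> I"
    by (rule ideal_UN_lessThan[OF I b])
  ultimately show ?thesis
    using I by (auto simp: is_ideal_def)
qed

lemma tukey_le_omega_power_if_no_pseudo_intersection:
  fixes X :: "nat \<Rightarrow> 'a set"
  assumes U: "is_ultrafilter U" and I: "is_ideal I" and "deterministic I"
    and IU: "I \<subseteq> dual_family U"
    and "antimono X" and X: "range X \<subseteq> U"
    and no: "\<And>Y. Y \<in> U \<Longrightarrow> \<exists>n. Y - X n \<notin> I"
  shows "tukey_le (omega_power I) (coordwise (\<subseteq>)) U (\<supseteq>)"
proof -
  obtain \<B> where \<B>: "is_cofinal I (\<subseteq>) \<B>"
    and det: "\<And>\<A>. \<A> \<subseteq> \<B> \<Longrightarrow> \<Union>\<A> \<in> I \<or> \<Union>\<A> \<in> dual_family I"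
    using \<open>deterministic I\<close> by (auto simp: deterministic_def)
  define Z where "Z b = (\<Union>n. b n \<inter> X n)" for b :: "nat \<Rightarrow> 'a set"
  define S where "S Y = {b \<in> UNIV \<rightarrow> \<B>. Y \<inter> Z b = {}}" for Y
  define f where "f Y n = (\<Union>b\<in>S Y. b n)" for Y n
  have Z: "UNIV - Z b \<in> U" if "b \<in> UNIV \<rightarrow> \<B>" for b
  proof -
    have "b n \<in> I" for n
      using that \<B> by (auto simp: is_cofinal_def)
    then have "Z b \<notin> U"
      using diagonal_diff_in_ideal[OF I \<open>antimono X\<close>] no unfolding Z_def by blast
    then show ?thesis
      using U by (auto simp: is_ultrafilter_def)
  qed
  have f: "f Y n \<in> I" if "Y \<in> U" for Y n
  proof (rule ccontr)
    assume "f Y n \<notin> I"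
    moreover have "(\<lambda>b. b n) ` S Y \<subseteq> \<B>"
      by (auto simp: S_def)
    ultimately have "f Y n \<in> dual_family I"
      using det unfolding f_def by blast
    then have "f Y n \<in> U"
      using IU by (auto simp: dual_family_def double_diff)
    moreover have "X n \<in> U"
      using X by blast
    ultimately have "Y \<inter> X n \<inter> f Y n \<in> U"
      using \<open>Y \<in> U\<close> U by (auto simp: is_ultrafilter_def is_set_filter_def)
    moreover have "Y \<inter> X n \<inter> f Y n = {}"
      by (auto simp: f_def S_def Z_def)
    ultimately show False
      using U by (simp add: is_ultrafilter_def is_set_filter_def)
  qed
  have "is_cofinal (omega_power I) (coordwise (\<subseteq>)) (f ` C)" if C: "is_cofinal U (\<supseteq>) C" for C
    unfolding is_cofinal_def
  proof (intro conjI ballI)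
    show "f ` C \<subseteq> omega_power I"
      using f C by (auto simp: omega_power_def is_cofinal_def)
    fix p assume "p \<in> omega_power I"
    then have "\<forall>n. \<exists>B\<in>\<B>. p n \<subseteq> B"
      using \<B> by (auto simp: omega_power_def is_cofinal_def)
    then obtain b where b: "b \<in> UNIV \<rightarrow> \<B>" "\<And>n. p n \<subseteq> b n"
      by (metis Pi_I)
    \<comment> \<open>Such a \<open>c\<close> misses \<open>Z b\<close>, so \<open>b\<close> is one
      of the sequences joined in \<open>f c\<close>.\<close>
    obtain c where c: "c \<in> C" "c \<subseteq> UNIV - Z b"
      using C Z[OF b(1)] by (auto simp: is_cofinal_def)
    then have "b \<in> S c"
      using b(1) by (auto simp: S_def)
    then have "coordwise (\<subseteq>) p (f c)"
      using b(2) unfolding coordwise_def f_def by blast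
    with c(1) show "\<exists>q\<in>f ` C. coordwise (\<subseteq>) p q"
      by blast
  qed
  moreover have "f \<in> U \<rightarrow> omega_power I"
    using f by (auto simp: omega_power_def)
  ultimately show ?thesis
    unfolding tukey_le_def by blast
qed

theorem theorem5p2:
  fixes U I :: "nat set set"
  assumes "is_ultrafilter U"
    and "is_ideal I"
    and "deterministic I"
    and "fin_ideal \<subseteq> I"
    and "I \<subseteq> dual_family U"
    and "\<not> tukey_le (omega_power I) (coordwise (\<subseteq>)) U (\<supseteq>)"
  shows "pseudo_intersection_property I U"
  unfolding pseudo_intersection_property_def
proof (intro allI impI)
  fix X :: "nat \<Rightarrow> nat set"
  assume X: "range X \<subseteq> U"
  \<comment> \<open>Finite intersections stay in \<open>U\<close> and make the sequence decreasing;
    as \<open>X' n \<subseteq> X n\<close>, a pseudo intersection for \<open>X'\<close> also serves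
    \<open>X\<close>.\<close>
  define X' where "X' n = (\<Inter>m\<le>n. X m)" for n
  have "antimono X'"
    by (auto simp: X'_def intro!: antimonoI)
  moreover have "range X' \<subseteq> U"
    using set_filter_INT_atMost[OF _ X] \<open>is_ultrafilter U\<close>
    by (auto simp: X'_def is_ultrafilter_def)
  ultimately obtain Y where Y: "Y \<in> U" "\<And>n. Y - X' n \<in> I"
    using tukey_le_omega_power_if_no_pseudo_intersection[of U I X'] assms by blast
  have "Y - X n \<subseteq> Y - X' n" for n
    by (auto simp: X'_def)
  with Y(2) have "Y - X n \<in> I" for n
    using \<open>is_ideal I\<close> unfolding is_ideal_def by blast
  with Y(1) show "\<exists>Y\<in>U. \<forall>n. Y - X n \<in> I"
    by blast
qed

end
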